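(* Let $n$ be an integer with $n \geq 20$ or with $n \in \{5,8,10,11,13,14,16,17\}$, and write $n = 3k + r$ with $r \in \{0,1,2\}$. Then there is an $n$-vertex $d$-regular $K_3$-saturated graph, where $d = k + (r-1)$.
   Context: All graphs are finite and simple. A graph $G$ is $K_3$-saturated if $G$ contains no triangle, but adding any edge between two nonadjacent vertices of $G$ creates a triangle. A graph is $d$-regular if every vertex has degree $d$. *)

theory Defs
  imports Main "HOL-Library.Ramsey"
begin

text \<open>
  A graph is given by a vertex set \<open>V\<close> and a set \<open>E\<close> of edges, each edge being a
  two-element subset of \<open>V\<close>; \<open>nsets V m\<close> is the library's set of \<open>m\<close>-element
  subsets of \<open>V\<close>.
\<close>

definition finite_simple_graph :: "'a set \<Rightarrow> 'a set set \<Rightarrow> bool" where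
  "finite_simple_graph V E \<longleftrightarrow> finite V \<and> E \<subseteq> nsets V 2"

definition has_triangle :: "'a set \<Rightarrow> 'a set set \<Rightarrow> bool" where
  "has_triangle V E \<longleftrightarrow> (\<exists>T \<in> nsets V 3. nsets T 2 \<subseteq> E)"

definition K3_saturated :: "'a set \<Rightarrow> 'a set set \<Rightarrow> bool" where
  "K3_saturated V E \<longleftrightarrow>
     \<not> has_triangle V E \<and>
     (\<forall>u \<in> V. \<forall>v \<in> V. u \<noteq> v \<and> {u, v} \<notin> E \<longrightarrow> has_triangle V (insert {u, v} E))"

definition degree :: "'a set set \<Rightarrow> 'a \<Rightarrow> nat" where
  "degree E v = card {e \<in> E. v \<in> e}"

definition regular_graph :: "'a set \<Rightarrow> 'a set set \<Rightarrow> nat \<Rightarrow> bool" where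
  "regular_graph V E d \<longleftrightarrow> (\<forall>v \<in> V. degree E v = d)"

end

theory Submission
  imports Defs
begin

text \<open>
  Up to the Petersen graph for \<open>n = 10\<close>, circulant graphs suffice: join \<open>x\<close> and \<open>y\<close> in
  \<open>\<int>/n\<close> when \<open>x - y\<close> lies in a symmetric set \<open>S\<close> of size \<open>d\<close>. Such a graph is
  \<open>K\<^sub>3\<close>-saturated if and only if \<open>S\<close> is sum-free and every nonzero element outside \<open>S\<close> is a
  difference of two elements of \<open>S\<close>. For \<open>r = 2\<close> we have \<open>n = 3d - 1\<close>, and the interval
  \<open>[d, 2d - 1]\<close> has these properties (the Andrasfai graphs). For \<open>r = 1\<close> and \<open>r = 0\<close>, where
  \<open>n = 3d + 1\<close> and \<open>n = 3d + 3\<close>, the middle interval with its ends thinned out and extended works: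
  \<open>{d} \<union> [d + 2, 2d - 1] \<union> {2d + 1}\<close> when \<open>d \<ge> 4\<close>, and
  \<open>{d, d + 2} \<union> [d + 4, 2d - 1] \<union> {2d + 1, 2d + 3}\<close> when \<open>d \<ge> 6\<close>.
\<close>

section \<open>Graphs given by an adjacency relation\<close>

lemma pair_mem_edges_iff:
  assumes "\<And>x y. adj x y \<Longrightarrow> adj y x" "x \<in> V" "y \<in> V"
  shows "{x, y} \<in> {{a, b} |a b. a \<in> V \<and> b \<in> V \<and> adj a b} \<longleftrightarrow> adj x y"
  using assms by (auto simp: doubleton_eq_iff)

text \<open>A new edge closes a triangle as soon as its ends have a common neighbour, so saturation
  reduces to triangle-freeness and \<open>common\<close>. Edges at \<open>v\<close> correspond to
  neighbours of \<open>v\<close>, which turns \<open>deg\<close> into regularity.\<close>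

lemma regular_K3_saturated_of_relation:
  fixes adj :: "'a \<Rightarrow> 'a \<Rightarrow> bool"
  assumes fin: "finite V"
    and sym: "\<And>x y. adj x y \<Longrightarrow> adj y x"
    and irrefl: "\<And>x. \<not> adj x x"
    and triangle_free:
      "\<And>x y z. \<lbrakk>x \<in> V; y \<in> V; z \<in> V; adj x y; adj y z; adj x z\<rbrakk> \<Longrightarrow> False"
    and common: "\<And>x y. \<lbrakk>x \<in> V; y \<in> V; x \<noteq> y; \<not> adj x y\<rbrakk> \<Longrightarrow> \<exists>w\<in>V. adj x w \<and> adj w y"
    and deg: "\<And>v. v \<in> V \<Longrightarrow> card {w \<in> V. adj v w} = d"
  shows "\<exists>E. finite_simple_graph V E \<and> regular_graph V E d \<and> K3_saturated V E"
proof (intro exI conjI)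
  define E where "E = {{a, b} |a b. a \<in> V \<and> b \<in> V \<and> adj a b}"
  have edge: "{x, y} \<in> E \<longleftrightarrow> adj x y" if "x \<in> V" "y \<in> V" for x y
    unfolding E_def using pair_mem_edges_iff[of adj x V y] sym that by blast
  show "finite_simple_graph V E"
    unfolding finite_simple_graph_def nsets_def E_def using fin irrefl
    by (auto simp: card_insert_if)
  show "regular_graph V E d"
    unfolding regular_graph_def degree_def
  proof
    fix v assume v: "v \<in> V"
    have "{e \<in> E. v \<in> e} = (\<lambda>w. {v, w}) ` {w \<in> V. adj v w}"
      unfolding E_def using v sym by (auto simp: doubleton_eq_iff)
    moreover have "inj_on (\<lambda>w. {v, w}) {w \<in> V. adj v w}"
      by (auto simp: inj_on_def doubleton_eq_iff)
    ultimately show "card {e \<in> E. v \<in> e} = d"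
      using deg[OF v] by (simp add: card_image)
  qed
  show "K3_saturated V E"
    unfolding K3_saturated_def
  proof (intro conjI ballI impI)
    show "\<not> has_triangle V E"
    proof
      assume "has_triangle V E"
      then obtain T where T: "T \<subseteq> V" "card T = 3" "nsets T 2 \<subseteq> E"
        by (auto simp: has_triangle_def nsets_def)
      then obtain x y z where xyz: "T = {x, y, z}" "x \<noteq> y" "y \<noteq> z" "x \<noteq> z"
        by (auto simp: card_3_iff)
      then have "{{x, y}, {y, z}, {x, z}} \<subseteq> nsets T 2"
        by (auto simp: nsets_def card_2_iff)
      then have "{x, y} \<in> E" "{y, z} \<in> E" "{x, z} \<in> E"
        using T(3) by blast+
      then show False
        using T(1) xyz(1) edge triangle_free[of x y z] by simp
    qed
  next
    fix u v assume uv: "u \<in> V" "v \<in> V" "u \<noteq> v \<and> {u, v} \<notin> E"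
    then obtain w where w: "w \<in> V" "adj u w" "adj w v"
      using common edge by metis
    have ne: "u \<noteq> w" "w \<noteq> v" "u \<noteq> v"
      using w irrefl uv by auto
    then have "{u, v, w} \<in> nsets V 3"
      using uv w by (auto simp: nsets_def)
    moreover have "nsets {u, v, w} 2 \<subseteq> insert {u, v} E"
    proof
      fix e assume "e \<in> nsets {u, v, w} 2"
      then obtain a b where "e = {a, b}" "a \<noteq> b" "a \<in> {u, v, w}" "b \<in> {u, v, w}"
        by (auto simp: nsets_def card_2_iff)
      then show "e \<in> insert {u, v} E"
        using edge uv w sym[OF w(3)] by (auto simp: insert_commute)
    qed
    ultimately show "has_triangle V (insert {u, v} E)"
      unfolding has_triangle_def by blast
  qed
qed

section \<open>Circulant graphs\<close>

text \<open>
  The residues modulo \<open>n\<close> are represented by \<open>{..<n}\<close>, and all conditions on \<open>S\<close> are stated without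
  reduction modulo \<open>n\<close>; the symmetry of \<open>S\<close> accounts for the sums that wrap around.
\<close>

lemma circulant_regular_K3_saturated:
  fixes S :: "nat set" and n :: nat
  assumes S: "S \<subseteq> {1..<n}"
    and sym: "\<And>s. s \<in> S \<Longrightarrow> n - s \<in> S"
    and sum_free: "\<And>a b. \<lbrakk>a \<in> S; b \<in> S\<rbrakk> \<Longrightarrow> a + b \<notin> S"
    and complete: "\<And>t. \<lbrakk>0 < t; t < n; t \<notin> S\<rbrakk> \<Longrightarrow> \<exists>a\<in>S. \<exists>b\<in>S. t = a + b \<or> a = t + b"
  shows "\<exists>E. finite_simple_graph {..<n} E \<and> regular_graph {..<n} E (card S) \<and>
           K3_saturated {..<n} E"
proof -
  define adj where "adj = (\<lambda>x y :: nat. (x < y \<and> y - x \<in> S) \<or> (y < x \<and> x - y \<in> S))"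
  have common_less: "\<exists>w\<in>{..<n}. adj x w \<and> adj w y" if xy: "x < y" "y < n" "\<not> adj x y" for x y
  proof -
    have "y - x \<notin> S"
      using xy by (auto simp: adj_def)
    then obtain a b where ab: "a \<in> S" "b \<in> S" "y - x = a + b \<or> a = y - x + b"
      using complete[of "y - x"] xy by (metis diff_less_mono2 less_imp_diff_less zero_less_diff)
    have pos: "0 < a" "a < n" "0 < b" "b < n"
      using ab S by auto
    show ?thesis
    \<comment> \<open>The common neighbour is \<open>x + a\<close> modulo \<open>n\<close>: it lies
      \<open>b\<close> before \<open>y\<close> if \<open>y - x = a + b\<close>, and \<open>b\<close>
      after \<open>y\<close> otherwise.\<close>
    proof (cases "x + a < n")
      case True
      have "adj x (x + a)"
        using ab pos by (simp add: adj_def)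
      moreover have "adj (x + a) y"
        using ab(3)
      proof
        assume "y - x = a + b"
        then have "y - (x + a) = b" "x + a < y"
          using pos xy by auto
        then show ?thesis
          using ab by (simp add: adj_def)
      next
        assume "a = y - x + b"
        then have "x + a - y = b" "y < x + a"
          using pos xy by auto
        then show ?thesis
          using ab by (simp add: adj_def)
      qed
      ultimately show ?thesis
        using True by auto
    next
      case False
      \<comment> \<open>Wrapping around forces \<open>a = y - x + b\<close>, since
        \<open>y - x = a + b\<close> would give \<open>x + a < y < n\<close>.\<close>
      define w where "w = x + a - n"
      have "x - w = n - a" "w < x"
        using False xy pos by (auto simp: w_def)
      then have "adj x w"
        using ab sym[of a] by (simp add: adj_def)
      have "y - w = n - b" "w < y"
        using False xy pos ab(3) by (auto simp: w_def)
      then have "adj w y"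
        using ab sym[of b] by (simp add: adj_def)
      then show ?thesis
        using \<open>adj x w\<close> \<open>w < x\<close> xy by auto
    qed
  qed
  have adj_sym: "adj x y \<Longrightarrow> adj y x" for x y
    by (auto simp: adj_def)
  show ?thesis
  proof (rule regular_K3_saturated_of_relation[of "{..<n}" adj])
    show "finite {..<n}" by simp
    show "adj y x" if "adj x y" for x y
      using adj_sym that .
    show "\<not> adj x x" for x
      by (simp add: adj_def)
  next
    fix x y z
    assume "adj x y" "adj y z" "adj x z"
    \<comment> \<open>Once the vertices of a triangle are sorted, the two gaps add up to the outer
      difference.\<close>
    have no_chain: False if "i < j" "j < k" "j - i \<in> S" "k - j \<in> S" "k - i \<in> S" for i j k
      using sum_free[of "j - i" "k - j"] that by simp
    show False
      using \<open>adj x y\<close> \<open>adj y z\<close> \<open>adj x z\<close> unfolding adj_def by (auto dest: no_chain)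
  next
    fix x y
    assume "x \<in> {..<n}" "y \<in> {..<n}" "x \<noteq> y" "\<not> adj x y"
    then show "\<exists>w\<in>{..<n}. adj x w \<and> adj w y"
      using common_less[of x y] common_less[of y x] adj_sym by (metis lessThan_iff linorder_neqE_nat)
  next
    fix v assume "v \<in> {..<n}"
    then have v: "v < n" by simp
    \<comment> \<open>Translation by \<open>v\<close> modulo \<open>n\<close>, a bijection from
      \<open>S\<close> to the neighbours of \<open>v\<close>.\<close>
    define f where "f = (\<lambda>s. if v + s < n then v + s else v + s - n)"
    have "{w \<in> {..<n}. adj v w} = f ` S"
    proof (intro equalityI subsetI)
      fix w assume "w \<in> {w \<in> {..<n}. adj v w}"
      then have w: "w < n" "adj v w" by auto
      then consider "v < w" "w - v \<in> S" | "w < v" "v - w \<in> S"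
        by (auto simp: adj_def)
      then show "w \<in> f ` S"
      proof cases
        case 1
        then have "w = f (w - v)"
          using w by (simp add: f_def)
        then show ?thesis
          using 1 by blast
      next
        case 2
        then have "w = f (n - (v - w))"
          using v by (simp add: f_def)
        then show ?thesis
          using 2 sym by blast
      qed
    next
      fix w assume "w \<in> f ` S"
      then obtain s where s: "s \<in> S" "w = f s" by blast
      then have "0 < s" "s < n"
        using S by auto
      moreover have "v - (v + s - n) = n - s" if "\<not> v + s < n"
        using that v \<open>s < n\<close> by simp
      ultimately show "w \<in> {w \<in> {..<n}. adj v w}"
        using s v sym[of s] by (auto simp: f_def adj_def)
    qed
    moreover have "inj_on f S"
    proof (rule inj_onI)
      fix s t assume "s \<in> S" "t \<in> S" "f s = f t"
      moreover have "s < n" "t < n"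
        using \<open>s \<in> S\<close> \<open>t \<in> S\<close> S by auto
      ultimately show "s = t"
        by (auto simp: f_def split: if_splits)
    qed
    ultimately show "card {w \<in> {..<n}. adj v w} = card S"
      by (simp add: card_image)
  qed
qed

section \<open>The three families of connection sets\<close>

text \<open>Sums start at \<open>2 * d\<close>, just beyond the interval. Differences with
  \<open>d\<close> cover what lies below it, sums with \<open>d\<close> what lies above.\<close>

lemma andrasfai_regular_K3_saturated:
  assumes "1 \<le> d"
  shows "\<exists>E. finite_simple_graph {..<3 * d - 1} E \<and> regular_graph {..<3 * d - 1} E d \<and>
           K3_saturated {..<3 * d - 1} E"
proof -
  have "\<exists>a\<in>{d..<2 * d}. \<exists>b\<in>{d..<2 * d}. t = a + b \<or> a = t + b"
    if t: "0 < t" "t < 3 * d - 1" "t \<notin> {d..<2 * d}" for t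
  proof (cases "t < d")
    case True
    then show ?thesis
      using assms by (intro bexI[of _ "d + t"] bexI[of _ d]) auto
  next
    case False
    then show ?thesis
      using t by (intro bexI[of _ "t - d"] bexI[of _ d]) auto
  qed
  then show ?thesis
    using circulant_regular_K3_saturated[of "{d..<2 * d}" "3 * d - 1"] assms by force
qed

text \<open>The only sum inside \<open>[d, 2 * d + 1]\<close> is \<open>d + d\<close>; removing
  \<open>2 * d\<close> and its mirror image \<open>d + 1\<close> restores sum-freeness and leaves
  \<open>d\<close> elements.\<close>

lemma circulant_one_regular_K3_saturated:
  assumes "4 \<le> d"
  shows "\<exists>E. finite_simple_graph {..<3 * d + 1} E \<and> regular_graph {..<3 * d + 1} E d \<and>
           K3_saturated {..<3 * d + 1} E"
proof -
  define S where "S = insert d (insert (2 * d + 1) {d + 2..<2 * d})"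
  have mem: "s \<in> S \<longleftrightarrow> s = d \<or> s = 2 * d + 1 \<or> d + 2 \<le> s \<and> s < 2 * d" for s
    by (auto simp: S_def)
  have card: "card S = d"
    unfolding S_def using assms by simp
  have "\<exists>a\<in>S. \<exists>b\<in>S. t = a + b \<or> a = t + b" if t: "0 < t" "t < 3 * d + 1" "t \<notin> S" for t
  proof -
    \<comment> \<open>The usual witnesses are \<open>d\<close> with \<open>d + t\<close> or
      \<open>t - d\<close>. For \<open>t = 1\<close> and \<open>t = 3 * d\<close> these hit the
      holes \<open>d + 1\<close> and \<open>2 * d\<close>; the replacements use
      \<open>4 \<le> d\<close>.\<close>
    consider "t = 1" | "2 \<le> t" "t < d" | "t = d + 1" | "t = 2 * d" | "2 * d + 2 \<le> t" "t < 3 * d"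
      | "t = 3 * d"
      using t unfolding mem by linarith
    then show ?thesis
    proof cases
      case 1
      then show ?thesis
        using assms by (intro bexI[of _ "d + 3"] bexI[of _ "d + 2"]) (auto simp: mem)
    next
      case 2
      then show ?thesis
        by (intro bexI[of _ "d + t"] bexI[of _ d]) (auto simp: mem)
    next
      case 3
      then show ?thesis
        by (intro bexI[of _ "2 * d + 1"] bexI[of _ d]) (auto simp: mem)
    next
      case 4
      then show ?thesis
        by (intro bexI[of _ d]) (auto simp: mem)
    next
      case 5
      then show ?thesis
        by (intro bexI[of _ "t - d"] bexI[of _ d]) (auto simp: mem)
    next
      case 6
      then show ?thesis
        using assms by (intro bexI[of _ "d + 2"] bexI[of _ "2 * d - 2"]) (auto simp: mem)
    qed
  qed
  moreover have "S \<subseteq> {1..<3 * d + 1}" "\<And>s. s \<in> S \<Longrightarrow> 3 * d + 1 - s \<in> S"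
    "\<And>a b. \<lbrakk>a \<in> S; b \<in> S\<rbrakk> \<Longrightarrow> a + b \<notin> S"
    using assms by (auto simp: mem)
  ultimately show ?thesis
    using circulant_regular_K3_saturated[of S "3 * d + 1"] card by simp
qed

text \<open>The only sums inside \<open>[d, 2 * d + 3]\<close> are \<open>2 * d\<close> and
  \<open>2 * d + 2\<close>; they are removed together with their mirror images \<open>d + 3\<close>
  and \<open>d + 1\<close>.\<close>

lemma circulant_three_regular_K3_saturated:
  assumes "6 \<le> d"
  shows "\<exists>E. finite_simple_graph {..<3 * d + 3} E \<and> regular_graph {..<3 * d + 3} E d \<and>
           K3_saturated {..<3 * d + 3} E"
proof -
  define S where
    "S = insert d (insert (d + 2) (insert (2 * d + 1) (insert (2 * d + 3) {d + 4..<2 * d})))"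
  have mem: "s \<in> S \<longleftrightarrow>
      s = d \<or> s = d + 2 \<or> s = 2 * d + 1 \<or> s = 2 * d + 3 \<or> d + 4 \<le> s \<and> s < 2 * d" for s
    by (auto simp: S_def)
  have card: "card S = d"
    unfolding S_def using assms by simp
  have "\<exists>a\<in>S. \<exists>b\<in>S. t = a + b \<or> a = t + b" if t: "0 < t" "t < 3 * d + 3" "t \<notin> S" for t
  proof -
    \<comment> \<open>The exceptional values \<open>1\<close>, \<open>3\<close>,
      \<open>3 * d\<close>, \<open>3 * d + 2\<close> are those for which \<open>d + t\<close> or
      \<open>t - d\<close> is one of the four holes.\<close>
    consider "t = 1" | "t = 3" | "t = 2 \<or> 4 \<le> t \<and> t < d" | "t = d + 1 \<or> t = d + 3"
      | "t = 2 * d \<or> t = 2 * d + 2 \<or> 2 * d + 4 \<le> t \<and> t < 3 * d \<or> t = 3 * d + 1"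
      | "t = 3 * d" | "t = 3 * d + 2"
      using t unfolding mem by atomize_elim presburger
    then show ?thesis
    proof cases
      case 1
      then show ?thesis
        using assms by (intro bexI[of _ "d + 5"] bexI[of _ "d + 4"]) (auto simp: mem)
    next
      case 2
      then show ?thesis
        using assms by (intro bexI[of _ "2 * d + 1"] bexI[of _ "2 * d - 2"]) (auto simp: mem)
    next
      case 3
      then show ?thesis
        by (intro bexI[of _ "d + t"] bexI[of _ d]) (auto simp: mem)
    next
      case 4
      then show ?thesis
        by (intro bexI[of _ "d + t"] bexI[of _ d]) (auto simp: mem)
    next
      case 5
      then show ?thesis
        by (intro bexI[of _ "t - d"] bexI[of _ d]) (auto simp: mem)
    next
      case 6
      then show ?thesis
        using assms by (intro bexI[of _ "d + 2"] bexI[of _ "2 * d - 2"]) (auto simp: mem)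
    next
      case 7
      then show ?thesis
        using assms by (intro bexI[of _ "d + 4"] bexI[of _ "2 * d - 2"]) (auto simp: mem)
    qed
  qed
  moreover have "S \<subseteq> {1..<3 * d + 3}" "\<And>s. s \<in> S \<Longrightarrow> 3 * d + 3 - s \<in> S"
    "\<And>a b. \<lbrakk>a \<in> S; b \<in> S\<rbrakk> \<Longrightarrow> a + b \<notin> S"
    using assms by (auto simp: mem)
  ultimately show ?thesis
    using circulant_regular_K3_saturated[of S "3 * d + 3"] card by simp
qed

section \<open>The Petersen graph\<close>

text \<open>The outer cycle is \<open>0, \<dots>, 4\<close>, and the spoke at \<open>i\<close> leads to \<open>i + 5\<close> on the inner pentagram.\<close>

definition petersen_edges :: "(nat \<times> nat) list" where
  "petersen_edges =
    [(0, 1), (1, 2), (2, 3), (3, 4), (4, 0),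
     (0, 5), (1, 6), (2, 7), (3, 8), (4, 9),
     (5, 7), (7, 9), (9, 6), (6, 8), (8, 5)]"

definition petersen_adj :: "nat \<Rightarrow> nat \<Rightarrow> bool" where
  "petersen_adj x y \<longleftrightarrow> (x, y) \<in> set petersen_edges \<or> (y, x) \<in> set petersen_edges"

text \<open>For \<open>d = 3\<close> the set of the \<open>3 * d + 1\<close> family would be
  \<open>{3, 5, 7}\<close>; all its elements are odd, so 1 is neither a sum nor a
  difference.\<close>

lemma petersen_regular_K3_saturated:
  "\<exists>E. finite_simple_graph {..<10} E \<and> regular_graph {..<10} E 3 \<and> K3_saturated {..<10::nat} E"
proof (rule regular_K3_saturated_of_relation[of "{..<10}" petersen_adj])
  \<comment> \<open>Ranging over a list makes the conditions executable.\<close>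
  have V: "x \<in> {..<10} \<longleftrightarrow> x \<in> set [0..<10]" for x :: nat
    by auto
  show "petersen_adj x y \<Longrightarrow> petersen_adj y x" for x y
    by (auto simp: petersen_adj_def)
  show "\<not> petersen_adj x x" for x
    by (auto simp: petersen_adj_def petersen_edges_def)
  have "\<forall>x\<in>set [0..<10]. \<forall>y\<in>set [0..<10]. petersen_adj x y \<longrightarrow>
      (\<forall>z\<in>set [0..<10]. \<not> (petersen_adj y z \<and> petersen_adj x z))"
    by code_simp
  then show False
    if "x \<in> {..<10}" "y \<in> {..<10}" "z \<in> {..<10}"
      "petersen_adj x y" "petersen_adj y z" "petersen_adj x z" for x y z
    using that unfolding V by blast
  have "\<forall>x\<in>set [0..<10]. \<forall>y\<in>set [0..<10]. x = y \<or> petersen_adj x y \<or>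
      (\<exists>w\<in>set [0..<10]. petersen_adj x w \<and> petersen_adj w y)"
    by code_simp
  then show "\<exists>w\<in>{..<10}. petersen_adj x w \<and> petersen_adj w y"
    if "x \<in> {..<10}" "y \<in> {..<10}" "x \<noteq> y" "\<not> petersen_adj x y" for x y
    using that unfolding V by (meson V)
  have "\<forall>v\<in>set [0..<10]. length (filter (petersen_adj v) [0..<10]) = 3"
    by code_simp
  moreover have "{w \<in> {..<10}. petersen_adj v w} = set (filter (petersen_adj v) [0..<10])" for v
    by auto
  ultimately show "card {w \<in> {..<10}. petersen_adj v w} = 3" if "v \<in> {..<10}" for v
    using that unfolding V by (metis distinct_card distinct_filter distinct_upt)
qed simp

theorem theorem3p2:
  fixes n k r d :: nat
  assumes "n \<ge> 20 \<or> n \<in> {5, 8, 10, 11, 13, 14, 16, 17}"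
    and "r \<in> {0, 1, 2}"
    and "n = 3 * k + r"
    and "int d = int k + (int r - 1)"
  shows "\<exists>(V :: nat set) E. finite_simple_graph V E \<and> card V = n \<and>
           regular_graph V E d \<and> K3_saturated V E"
proof -
  have "\<exists>E. finite_simple_graph {..<n} E \<and> regular_graph {..<n} E d \<and> K3_saturated {..<n} E"
  proof -
    consider "r = 0" | "r = 1" | "r = 2"
      using assms(2) by auto
    then show ?thesis
    proof cases
      case 1
      \<comment> \<open>None of the small values of \<open>n\<close> is divisible by 3, so
        \<open>n\<close> is at least 21.\<close>
      then have "6 \<le> d" "n = 3 * d + 3"
        using assms by auto presburger+
      then show ?thesis
        using circulant_three_regular_K3_saturated by simp
    next
      case 2
      \<comment> \<open>Here \<open>d = k\<close>, and among the admissible \<open>n\<close> only 10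
        gives \<open>d < 4\<close>.\<close>
      then have n: "n = 3 * d + 1" and "n = 10 \<or> 4 \<le> d"
        using assms by auto presburger+
      then consider "n = 10" "d = 3" | "4 \<le> d"
        by linarith
      then show ?thesis
        using petersen_regular_K3_saturated circulant_one_regular_K3_saturated n by cases simp_all
    next
      case 3
      then have "1 \<le> d" "n = 3 * d - 1"
        using assms by auto
      then show ?thesis
        using andrasfai_regular_K3_saturated by simp
    qed
  qed
  then show ?thesis
    using card_lessThan by blast
qed

end
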